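(* Let $\lambda$ be a nonzero real number, let $n\ge 0$ be an integer, and let $m\in\mathbb{N}$ with $m\equiv 1 \pmod 2$. Then $$\mathcal{E}_{n,\lambda}+\mathcal{E}_{n,\lambda}(m)=2\sum_{k=0}^{n}\sum_{l=0}^{m-1}(-1)^l\, S_{1,\lambda}(n,k)\, l^k ,$$ with the convention $0^0=1$.
   Context: For $\lambda\neq 0$ the degenerate falling factorials are $(x)_{0,\lambda}=1$ and $(x)_{n,\lambda}=x(x-\lambda)(x-2\lambda)\cdots(x-(n-1)\lambda)$ for $n\ge1$. The degenerate Stirling numbers of the first kind $S_{1,\lambda}(n,k)$ are defined by $(x)_{n,\lambda}=\sum_{k=0}^n S_{1,\lambda}(n,k)x^k$ for $n\ge 0$. The degenerate Euler polynomials $\mathcal{E}_{n,\lambda}(x)$ are defined by the generating function $\frac{2}{(1+\lambda t)^{1/\lambda}+1}(1+\lambda t)^{x/\lambda}=\sum_{n=0}^\infty \mathcal{E}_{n,\lambda}(x)\frac{t^n}{n!}$, and the degenerate Euler numbers are $\mathcal{E}_{n,\lambda}=\mathcal{E}_{n,\lambda}(0)$. *)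

theory Defs
  imports "HOL-Computational_Algebra.Computational_Algebra"
begin

text \<open>
  The definition is polymorphic so that it applies both to numbers and, for reading off
  coefficients, to the polynomial indeterminate.
\<close>

definition deg_ffact :: "'a::comm_ring_1 \<Rightarrow> 'a \<Rightarrow> nat \<Rightarrow> 'a" where
  "deg_ffact lam x n = (\<Prod>i<n. x - of_nat i * lam)"

definition deg_stirling1 :: "real \<Rightarrow> nat \<Rightarrow> nat \<Rightarrow> real" where
  "deg_stirling1 lam n k = coeff (deg_ffact [:lam:] [:0, 1:] n) k"

text \<open>
  The formal power series \<open>(1 + lam * t) powr (x / lam)\<close> in \<open>t\<close>, obtained by substituting
  \<open>lam * t\<close> for the indeterminate of the binomial series \<open>fps_binomial (x / lam)\<close>.
\<close>

definition deg_exp :: "real \<Rightarrow> real \<Rightarrow> real fps" where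
  "deg_exp lam x = fps_binomial (x / lam) oo (fps_const lam * fps_X)"

definition deg_euler_poly :: "real \<Rightarrow> nat \<Rightarrow> real \<Rightarrow> real" where
  "deg_euler_poly lam n x =
     fact n * fps_nth (2 / (deg_exp lam 1 + 1) * deg_exp lam x) n"

definition deg_euler_number :: "real \<Rightarrow> nat \<Rightarrow> real" where
  "deg_euler_number lam n = deg_euler_poly lam n 0"

lemma poly_deg_ffact: "poly (deg_ffact [:lam:] [:0, 1:] n) x = deg_ffact lam x n"
  for lam x :: real
  by (simp add: deg_ffact_def poly_prod mult.commute)

lemma degree_deg_ffact: "degree (deg_ffact [:lam:] [:0, 1:] n) \<le> n"
  for lam :: real
proof (induction n)
  case 0
  show ?case by (simp add: deg_ffact_def)
next
  case (Suc n)
  have "degree ([:0, 1:] - of_nat n * [:lam:]) \<le> 1"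
    by (simp add: of_nat_poly)
  then have "degree (deg_ffact [:lam:] [:0, 1:] n * ([:0, 1:] - of_nat n * [:lam:])) \<le> n + 1"
    by (intro order.trans[OF degree_mult_le] add_mono Suc)
  then show ?case by (simp add: deg_ffact_def)
qed

lemma deg_ffact_eq_sum: "deg_ffact lam x n = (\<Sum>k\<le>n. deg_stirling1 lam n k * x ^ k)"
proof -
  let ?p = "deg_ffact [:lam:] [:0, 1:] n"
  have "(\<Sum>k\<le>degree ?p. coeff ?p k * x ^ k) = (\<Sum>k\<le>n. coeff ?p k * x ^ k)"
    by (rule sum.mono_neutral_left) (use degree_deg_ffact[of lam n] in \<open>auto simp: coeff_eq_0\<close>)
  then show ?thesis
    by (simp add: deg_stirling1_def poly_deg_ffact[symmetric] poly_altdef)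
qed

lemma fps_nth_deg_exp:
  assumes "lam \<noteq> 0"
  shows "fps_nth (deg_exp lam x) n = deg_ffact lam x n / fact n"
proof -
  have "(\<Prod>i<n. x - of_nat i * lam) = (\<Prod>i<n. lam * (x / lam - of_nat i))"
    using assms by (intro prod.cong) (auto simp: field_simps)
  then show ?thesis
    by (simp add: deg_exp_def deg_ffact_def fps_compose_linear gbinomial_prod_rev
        prod.distrib atLeast0LessThan)
qed

lemma deg_euler_gf:
  "2 / (deg_exp lam 1 + 1) * deg_exp lam x = Abs_fps (\<lambda>n. deg_euler_poly lam n x / fact n)"
  by (simp add: fps_eq_iff deg_euler_poly_def)

lemma deg_exp_1_plus_1_invertible: "fps_nth (deg_exp lam 1 + 1) 0 \<noteq> 0"
  by (simp add: deg_exp_def)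

end

theory Submission
  imports Defs
begin

text \<open>
  Multiplying the generating function by \<open>deg_exp lam 1 + 1\<close> gives the difference equation
  \<open>E\<^sub>n(x) + E\<^sub>n(x + 1) = 2 (x)\<^sub>n\<close>. Its alternating sum over \<open>x = 0, \<dots>, m - 1\<close> telescopes to
  \<open>E\<^sub>n(0) + E\<^sub>n(m)\<close> for odd \<open>m\<close>, and expanding the falling factorials \<open>(l)\<^sub>n\<close> in powers of \<open>l\<close>
  yields the Stirling numbers.
\<close>

text \<open>Vandermonde's identity for binomial series; substituting \<open>lam * t\<close> respects
  products.\<close>

lemma deg_exp_add: "deg_exp lam (x + y) = deg_exp lam x * deg_exp lam y"
  by (simp add: deg_exp_def add_divide_distrib fps_binomial_add_mult fps_compose_mult_distrib)

lemma deg_euler_poly_plus_1: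
  assumes "lam \<noteq> 0"
  shows "deg_euler_poly lam n x + deg_euler_poly lam n (x + 1) = 2 * deg_ffact lam x n"
proof -
  let ?D = "deg_exp lam 1 + 1"
  have "2 / ?D * deg_exp lam x + 2 / ?D * deg_exp lam (x + 1) = (2 / ?D * ?D) * deg_exp lam x"
    by (simp add: deg_exp_add algebra_simps)
  \<comment> \<open>The division cancels because \<open>?D\<close> has constant coefficient 2, so it
    is a unit.\<close>
  also have "2 / ?D * ?D = 2"
    using deg_exp_1_plus_1_invertible[of lam]
    by (simp add: fps_divide_unit mult.assoc inverse_mult_eq_1)
  finally have "fps_nth (2 / ?D * deg_exp lam x) n + fps_nth (2 / ?D * deg_exp lam (x + 1)) n
      = 2 * fps_nth (deg_exp lam x) n"
    by (metis fps_add_nth fps_mult_left_const_nth fps_numeral_fps_const)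
  then have "fact n * fps_nth (2 / ?D * deg_exp lam x) n
      + fact n * fps_nth (2 / ?D * deg_exp lam (x + 1)) n = fact n * (2 * fps_nth (deg_exp lam x) n)"
    by (metis distrib_left)
  then show ?thesis
    unfolding deg_euler_poly_def by (simp add: fps_nth_deg_exp assms)
qed

lemma sum_alternating_telescope:
  fixes f :: "nat \<Rightarrow> 'a::comm_ring_1"
  shows "(\<Sum>l<m. (-1) ^ l * (f l + f (Suc l))) = f 0 - (-1) ^ m * f m"
  by (induction m) (simp_all add: algebra_simps)

theorem theorem1:
  fixes lam :: real and n m :: nat
  assumes "lam \<noteq> 0" and "odd m"
  shows "deg_euler_number lam n + deg_euler_poly lam n (real m) =
    2 * (\<Sum>k=0..n. \<Sum>l=0..m-1. (-1) ^ l * deg_stirling1 lam n k * real l ^ k)"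
proof -
  let ?E = "\<lambda>l. deg_euler_poly lam n (real l)"
  \<comment> \<open>At \<open>m = 0\<close> truncated subtraction would give \<open>{0}\<close> on
    the left; oddness excludes this.\<close>
  have range: "{0..m-1} = {..<m}"
    using \<open>odd m\<close> by (cases m) auto
  \<comment> \<open>For odd \<open>m\<close> the boundary term \<open>- (-1) ^ m * ?E m\<close> is
    \<open>+ ?E m\<close>.\<close>
  have "deg_euler_number lam n + ?E m = (\<Sum>l<m. (-1) ^ l * (?E l + ?E (Suc l)))"
    using sum_alternating_telescope[of ?E m] \<open>odd m\<close> by (simp add: deg_euler_number_def)
  also have "\<dots> = 2 * (\<Sum>l<m. (-1) ^ l * deg_ffact lam (real l) n)"
    using deg_euler_poly_plus_1[OF \<open>lam \<noteq> 0\<close>, of n "real l" for l]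
    by (simp add: sum_distrib_left mult.left_commute add.commute[of 1])
  also have "(\<Sum>l<m. (-1) ^ l * deg_ffact lam (real l) n)
      = (\<Sum>l<m. \<Sum>k=0..n. (-1) ^ l * deg_stirling1 lam n k * real l ^ k)"
    by (simp add: deg_ffact_eq_sum sum_distrib_left mult.assoc atLeast0AtMost)
  also have "\<dots> = (\<Sum>k=0..n. \<Sum>l=0..m-1. (-1) ^ l * deg_stirling1 lam n k * real l ^ k)"
    unfolding range by (rule sum.swap)
  finally show ?thesis .
qed

end
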